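(* Let $\mathbb{O}$ be a finite set of $K\ge 2$ objects, let $\mathbb{D}=\{\pi_1,\dots,\pi_N\}$, $N\ge 1$, be a database of (possibly incomplete) rankings over $\mathbb{O}$, and let $\delta>0$ be a support threshold. Then the algorithm GPMiner (described in the context) is correct: it finds all closed rankings, and all rankings found by the algorithm (i.e. contained in its final output) are closed.
   Context: An (incomplete) ranking over $\mathbb{O}$ is a total order of a subset of at least two objects, written as a sequence $\rho=(o_{i_1},\dots,o_{i_k})$ of pairwise distinct objects, $2\le k\le K$, meaning $o_{i_1}\succ\dots\succ o_{i_k}$; $O(\rho)=\{o_{i_1},\dots,o_{i_k}\}$ and $last(\rho)=o_{i_k}$. The set of all such rankings is $\overline{\mathbb{S}}_K$. Write $\rho\subset\rho'$ ($\rho$ is a subranking of $\rho'$, $\rho'$ a superranking of $\rho$) if $O(\rho)\subseteq O(\rho')$ and $\rho'$ puts the objects of $O(\rho)$ in the same relative order as $\rho$; $\rho\subsetneq\rho'$ means $\rho\subset\rho'$ and $\rho'\not\subset\rho$. A prefix of $\rho=(o_{i_1},\dots,o_{i_k})$ is a subranking of the form $(o_{i_1},\dots,o_{i_p})$ with $p\le k$. The members of $\mathbb{D}$ are called transactions; $g(\rho)=\{\pi_i\in\mathbb{D} : \rho\subset\pi_i\}$ and $\operatorname{supp}(\rho)=\#g(\rho)/N$. A ranking $\rho$ is frequent if $\operatorname{supp}(\rho)\ge\delta$, and closed if it is frequent and $\operatorname{supp}(\rho')<\operatorname{supp}(\rho)$ for every $\rho'$ with $\rho\subsetneq\rho'$.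 For a ranking $\rho$ with $g(\rho)\ne\emptyset$, the h-closure $h(\rho)$ is the maximal intersection of the transactions in $g(\rho)$: the set of all $\sigma\in\overline{\mathbb{S}}_K$ that are subrankings of every transaction in $g(\rho)$ and that are maximal with this property with respect to $\subset$. The c-closure is $c(\rho)=\{\rho'\in h(\rho) : \rho\subset\rho'\}$. For $o\notin O(\rho)$, the tail extension $\rho\,|\,o$ is the ranking obtained from $\rho$ by appending $o$ at the last position. Algorithm GPMiner: traverse the space of rankings depth-first by tail extension. The initial candidates are all frequent rankings of length 2; once a ranking $\rho$ has been accepted, its candidates are the tail extensions $\rho\,|\,o$ over all objects $o$ such that $(last(\rho),o)$ is a frequent 2-ranking. Each candidate $\sigma$ is treated as follows. (1) Frequency check: if $\sigma$ is not frequent (for $\sigma=\rho\,|\,o$, this is decided from $g(\rho)\cap g((last(\rho),o))$), it is pruned together with its whole subtree (all its further extensions). (2) Otherwise $h(\sigma)$ is computed. (3) Prefix test: if $\sigma$ is not a prefix of any element of $h(\sigma)$ (equivalently, of any element of $c(\sigma)$), it is pruned together with its whole subtree. (4) Otherwise $\sigma$ is accepted, i.e. stored in the result list, and the recursion continues with the candidates extending $\sigma$; after all these have been explored, $\sigma$ is deleted from the result list if some accepted candidate $\sigma\,|\,o$ satisfies $g(\sigma\,|\,o)=g(\sigma)$. The output is the final result list. *)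

theory Defs
  imports Complex_Main "HOL-Library.Sublist"
begin

text \<open>A ranking is encoded as the list of its objects, most preferred object first.\<close>

definition rankings :: "'a set \<Rightarrow> 'a list set" where
  "rankings Ob = {\<rho>. distinct \<rho> \<and> set \<rho> \<subseteq> Ob \<and> 2 \<le> length \<rho> \<and> length \<rho> \<le> card Ob}"

definition above :: "'a list \<Rightarrow> 'a \<Rightarrow> 'a \<Rightarrow> bool" where
  "above \<rho> x y \<longleftrightarrow> (\<exists>i j. i < j \<and> j < length \<rho> \<and> \<rho> ! i = x \<and> \<rho> ! j = y)"

definition subranking :: "'a list \<Rightarrow> 'a list \<Rightarrow> bool" where
  "subranking \<rho> \<rho>' \<longleftrightarrow>
     set \<rho> \<subseteq> set \<rho>' \<and> (\<forall>x\<in>set \<rho>. \<forall>y\<in>set \<rho>. above \<rho> x y \<longleftrightarrow> above \<rho>' x y)"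

definition strict_subranking :: "'a list \<Rightarrow> 'a list \<Rightarrow> bool" where
  "strict_subranking \<rho> \<rho>' \<longleftrightarrow> subranking \<rho> \<rho>' \<and> \<not> subranking \<rho>' \<rho>"

text \<open>The database is the family \<open>\<pi> 1, \<dots>, \<pi> N\<close>. Transactions are identified by their index, so
  that a ranking occurring several times in the database is counted with multiplicity.\<close>

definition g :: "nat \<Rightarrow> (nat \<Rightarrow> 'a list) \<Rightarrow> 'a list \<Rightarrow> nat set" where
  "g N \<pi> \<rho> = {i \<in> {1..N}. subranking \<rho> (\<pi> i)}"

definition supp :: "nat \<Rightarrow> (nat \<Rightarrow> 'a list) \<Rightarrow> 'a list \<Rightarrow> real" where
  "supp N \<pi> \<rho> = real (card (g N \<pi> \<rho>)) / real N"

definition frequent_ranking ::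
  "'a set \<Rightarrow> nat \<Rightarrow> (nat \<Rightarrow> 'a list) \<Rightarrow> real \<Rightarrow> 'a list \<Rightarrow> bool" where
  "frequent_ranking Ob N \<pi> \<delta> \<rho> \<longleftrightarrow> \<rho> \<in> rankings Ob \<and> \<delta> \<le> supp N \<pi> \<rho>"

definition closed_ranking ::
  "'a set \<Rightarrow> nat \<Rightarrow> (nat \<Rightarrow> 'a list) \<Rightarrow> real \<Rightarrow> 'a list \<Rightarrow> bool" where
  "closed_ranking Ob N \<pi> \<delta> \<rho> \<longleftrightarrow>
     frequent_ranking Ob N \<pi> \<delta> \<rho> \<and>
     (\<forall>\<rho>'\<in>rankings Ob. strict_subranking \<rho> \<rho>' \<longrightarrow> supp N \<pi> \<rho>' < supp N \<pi> \<rho>)"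

definition common_subrankings ::
  "'a set \<Rightarrow> (nat \<Rightarrow> 'a list) \<Rightarrow> nat set \<Rightarrow> 'a list set" where
  "common_subrankings Ob \<pi> T = {\<sigma> \<in> rankings Ob. \<forall>i\<in>T. subranking \<sigma> (\<pi> i)}"

text \<open>Only meaningful for rankings with at least one supporting transaction.\<close>

definition h_closure ::
  "'a set \<Rightarrow> nat \<Rightarrow> (nat \<Rightarrow> 'a list) \<Rightarrow> 'a list \<Rightarrow> 'a list set" where
  "h_closure Ob N \<pi> \<rho> =
     {\<sigma> \<in> common_subrankings Ob \<pi> (g N \<pi> \<rho>).
        \<not> (\<exists>\<tau>\<in>common_subrankings Ob \<pi> (g N \<pi> \<rho>). strict_subranking \<sigma> \<tau>)}"

text \<open>The algorithm works with an enumeration \<open>objs\<close> of the objects, which fixes the order in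
  which candidates are visited. A candidate \<open>\<sigma>\<close> comes with a set \<open>T\<close> of transactions from which
  its frequency is decided: \<open>T\<close> is the set of supporting transactions if \<open>\<sigma>\<close> has length 2, and
  \<open>g(\<rho>) \<inter> g((last \<rho>, x))\<close> if \<open>\<sigma>\<close> is the tail extension of \<open>\<rho>\<close> by \<open>x\<close>.\<close>

definition accepted ::
  "'a list \<Rightarrow> nat \<Rightarrow> (nat \<Rightarrow> 'a list) \<Rightarrow> real \<Rightarrow> nat set \<Rightarrow> 'a list \<Rightarrow> bool" where
  "accepted objs N \<pi> \<delta> T \<sigma> \<longleftrightarrow>
     \<delta> \<le> real (card T) / real N \<and> (\<exists>\<eta>\<in>h_closure (set objs) N \<pi> \<sigma>. prefix \<sigma> \<eta>)"

definition tail_objects ::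
  "'a list \<Rightarrow> nat \<Rightarrow> (nat \<Rightarrow> 'a list) \<Rightarrow> real \<Rightarrow> 'a list \<Rightarrow> 'a list" where
  "tail_objects objs N \<pi> \<delta> \<rho> =
     filter (\<lambda>x. x \<notin> set \<rho> \<and> frequent_ranking (set objs) N \<pi> \<delta> [last \<rho>, x]) objs"

definition tail_transactions ::
  "nat \<Rightarrow> (nat \<Rightarrow> 'a list) \<Rightarrow> 'a list \<Rightarrow> 'a \<Rightarrow> nat set" where
  "tail_transactions N \<pi> \<rho> x = g N \<pi> \<rho> \<inter> g N \<pi> [last \<rho>, x]"

text \<open>\<open>explore \<dots> T \<sigma> R\<close> treats the candidate \<open>\<sigma>\<close> and its whole subtree, starting with the
  result list \<open>R\<close>, and returns the updated result list.\<close>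

function explore ::
  "'a list \<Rightarrow> nat \<Rightarrow> (nat \<Rightarrow> 'a list) \<Rightarrow> real \<Rightarrow> nat set \<Rightarrow> 'a list \<Rightarrow> 'a list list \<Rightarrow> 'a list list"
where
  "explore objs N \<pi> \<delta> T \<sigma> R =
     (if \<not> accepted objs N \<pi> \<delta> T \<sigma> then R
      else
        let R' = fold (\<lambda>x S. explore objs N \<pi> \<delta> (tail_transactions N \<pi> \<sigma> x) (\<sigma> @ [x]) S)
                   (tail_objects objs N \<pi> \<delta> \<sigma>) (R @ [\<sigma>])
        in if \<exists>x\<in>set (tail_objects objs N \<pi> \<delta> \<sigma>).
                accepted objs N \<pi> \<delta> (tail_transactions N \<pi> \<sigma> x) (\<sigma> @ [x]) \<and>
                g N \<pi> (\<sigma> @ [x]) = g N \<pi> \<sigma>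
           then removeAll \<sigma> R' else R')"
  by pat_completeness auto
termination
proof (relation "measure (\<lambda>(objs, N, \<pi>, \<delta>, T, \<sigma>, R). card (set objs - set \<sigma>))", goal_cases)
  case 1
  show ?case by simp
next
  case (2 objs N \<pi> \<delta> T \<sigma> R x S)
  then have "set objs - set (\<sigma> @ [x]) \<subset> set objs - set \<sigma>"
    by (auto simp: tail_objects_def)
  then show ?case
    by (auto intro: psubset_card_mono)
qed

declare explore.simps [simp del]

definition gpminer ::
  "'a list \<Rightarrow> nat \<Rightarrow> (nat \<Rightarrow> 'a list) \<Rightarrow> real \<Rightarrow> 'a list list" where
  "gpminer objs N \<pi> \<delta> =
     fold (\<lambda>\<sigma> R. explore objs N \<pi> \<delta> (g N \<pi> \<sigma>) \<sigma> R)
       (filter (frequent_ranking (set objs) N \<pi> \<delta>) [[x, y]. x \<leftarrow> objs, y \<leftarrow> objs]) []"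

end

theory Submission
  imports Defs
begin

text \<open>On duplicate-free lists, being a subranking is being a subsequence. Cutting transactions at
  the last object of \<open>\<sigma>\<close> yields both halves of the argument. If \<open>\<sigma>\<close> is a prefix of a closed ranking
  \<open>\<rho> = \<sigma> @ r\<close>, and \<open>\<eta>\<close> is a maximal common subranking of \<open>g(\<sigma>)\<close> above \<open>\<sigma>\<close>, then the part of \<open>\<eta>\<close>
  up to \<open>last \<sigma>\<close>, followed by \<open>r\<close>, is contained in every transaction of \<open>g(\<rho>)\<close>; as \<open>\<rho>\<close> is closed,
  that part is \<open>\<sigma>\<close> itself, so \<open>\<sigma>\<close> passes the prefix test and \<open>\<rho>\<close> is reached. Conversely, an accepted
  \<open>\<sigma>\<close> that is not closed is a proper prefix of some \<open>\<eta> \<in> h(\<sigma>)\<close>; its extension by the next object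
  of \<open>\<eta>\<close> has the same transactions and the same h-closure, hence is accepted and deletes \<open>\<sigma>\<close>.\<close>

section \<open>Subrankings of duplicate-free lists as subsequences\<close>

lemma above_Nil [simp]: "\<not> above [] x y"
  by (simp add: above_def)

lemma above_Cons [simp]:
  "above (a # l) x y \<longleftrightarrow> x = a \<and> y \<in> set l \<or> above l x y" (is "?L \<longleftrightarrow> ?R")
proof
  assume ?L
  then obtain i j where ij: "i < j" "j < length (a # l)" "(a # l) ! i = x" "(a # l) ! j = y"
    by (auto simp: above_def)
  then obtain j' where j: "j = Suc j'"
    by (cases j) auto
  show ?R
  proof (cases i)
    case 0
    then show ?thesis using ij j by auto
  next
    case (Suc i')
    then have "above l x y"
      using ij j unfolding above_def by (intro exI[of _ i'] exI[of _ j']) auto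
    then show ?thesis ..
  qed
next
  assume ?R
  then show ?L
  proof
    assume "x = a \<and> y \<in> set l"
    then obtain j where "j < length l" "l ! j = y" "x = a"
      by (auto simp: in_set_conv_nth)
    then show ?L
      unfolding above_def by (intro exI[of _ 0] exI[of _ "Suc j"]) auto
  next
    assume "above l x y"
    then obtain i j where "i < j" "j < length l" "l ! i = x" "l ! j = y"
      by (auto simp: above_def)
    then show ?L
      unfolding above_def by (intro exI[of _ "Suc i"] exI[of _ "Suc j"]) auto
  qed
qed

lemma above_in_set: "above l x y \<Longrightarrow> x \<in> set l \<and> y \<in> set l"
  by (induction l) auto

lemma above_asym: "distinct l \<Longrightarrow> above l x y \<Longrightarrow> \<not> above l y x"
  by (induction l) (auto dest: above_in_set)

lemma above_total: "x \<in> set l \<Longrightarrow> y \<in> set l \<Longrightarrow> x \<noteq> y \<Longrightarrow> above l x y \<or> above l y x"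
  by (induction l) auto

lemma above_subseq: "subseq \<rho> \<rho>' \<Longrightarrow> above \<rho> x y \<Longrightarrow> above \<rho>' x y"
  by (induction rule: list_emb.induct) (auto dest: list_emb_set)

lemma set_subseq: "subseq xs ys \<Longrightarrow> set xs \<subseteq> set ys"
  by (auto elim: list_emb_set)

lemma subseq_distinct: "subseq xs ys \<Longrightarrow> distinct ys \<Longrightarrow> distinct xs"
  by (induction rule: list_emb.induct) (auto dest: list_emb_set)

lemma subseq_if_subranking:
  "distinct \<rho>' \<Longrightarrow> subranking \<rho> \<rho>' \<Longrightarrow> subseq \<rho> \<rho>'"
proof (induction \<rho>' arbitrary: \<rho>)
  case Nil
  then show ?case by (simp add: subranking_def)
next
  case (Cons y ys)
  show ?case
  proof (cases "y \<in> set \<rho>")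
    case False
    then have "subranking \<rho> ys"
      using Cons.prems by (fastforce simp: subranking_def)
    then show ?thesis
      using Cons by auto
  next
    case True
    then obtain z zs where \<rho>: "\<rho> = z # zs"
      by (cases \<rho>) auto
    \<comment> \<open>Otherwise \<open>z\<close> is above \<open>y\<close> in \<open>\<rho>\<close>,
      hence in \<open>y # ys\<close>; but nothing is above the head of a duplicate-free
      list.\<close>
    have "y \<notin> set zs"
      using Cons.prems by (auto simp: subranking_def \<rho> dest: above_in_set)
    then have "z = y"
      using True \<rho> by auto
    moreover have "subranking zs ys"
      using Cons.prems \<open>y \<notin> set zs\<close> by (fastforce simp: subranking_def \<rho> \<open>z = y\<close>)
    ultimately show ?thesis
      using Cons \<rho> by auto
  qed
qed

text \<open>Embeddings preserve \<open>above\<close>. They also reflect it: \<open>\<rho>\<close>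
  orders any two of its objects one way or the other, and the wrong way would contradict asymmetry
  in \<open>\<rho>'\<close>.\<close>

lemma subranking_if_subseq:
  assumes "distinct \<rho>'" and sub: "subseq \<rho> \<rho>'"
  shows "subranking \<rho> \<rho>'"
proof -
  have "above \<rho> x y" if "x \<in> set \<rho>" "y \<in> set \<rho>" "above \<rho>' x y" for x y
  proof -
    have "\<not> above \<rho>' y x"
      using above_asym assms(1) that(3) by metis
    then have "x \<noteq> y" "\<not> above \<rho> y x"
      using that(3) above_subseq[OF sub] by auto
    then show ?thesis
      using above_total that by metis
  qed
  then show ?thesis
    using above_subseq[OF sub] set_subseq[OF sub] by (auto simp: subranking_def)
qed

lemma subranking_iff_subseq: "distinct \<rho>' \<Longrightarrow> subranking \<rho> \<rho>' \<longleftrightarrow> subseq \<rho> \<rho>'"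
  using subseq_if_subranking subranking_if_subseq by blast

section \<open>Cutting and splicing subsequences at a common object\<close>

lemma subseq_split_distinct:
  assumes "distinct (u @ z # v)" and "subseq (a @ z # b) (u @ z # v)"
  shows "subseq a u" and "subseq b v"
proof -
  obtain us vs where 1: "u @ z # v = us @ vs" "subseq a us" "subseq (z # b) vs"
    using list_emb_appendD[OF assms(2)] by blast
  obtain us' vs' where 2: "vs = us' @ z # vs'" "subseq b vs'"
    using list_emb_ConsD[OF 1(3)] by blast
  have "u @ z # v = (us @ us') @ z # vs'"
    using 1 2 by simp
  moreover have "z \<notin> set u" "z \<notin> set v"
    using assms(1) by auto
  \<comment> \<open>An object that occurs only once determines the decomposition around it.\<close>
  ultimately have "u = us @ us' \<and> v = vs'"
    using append_Cons_eq_iff by metis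
  then show "subseq a u" "subseq b v"
    using 1 2 by auto
qed

text \<open>Both embeddings send \<open>z\<close> to its single position in \<open>\<pi>\<close>, so
  the left half of one and the right half of the other meet there.\<close>

lemma subseq_splice:
  assumes "distinct \<pi>" "subseq (a @ z # b) \<pi>" "subseq (c @ z # d) \<pi>"
  shows "subseq (a @ z # d) \<pi>"
proof -
  have "z \<in> set \<pi>"
    using set_subseq[OF assms(2)] by auto
  then obtain u v where \<pi>: "\<pi> = u @ z # v"
    by (meson split_list)
  show ?thesis
    using subseq_split_distinct assms unfolding \<pi> by (metis list_emb_append_mono subseq_Cons2)
qed

text \<open>Serves completeness: a closed ranking enters the result list at one particular candidate
  and survives all later ones.\<close>

lemma fold_establishes:
  assumes "x \<in> set xs" "\<And>s. P (f x s)" "\<And>y s. P s \<Longrightarrow> P (f y s)"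
  shows "P (fold f xs s)"
proof -
  obtain as bs where "xs = as @ x # bs"
    using assms(1) by (meson split_list)
  moreover have "P (fold f bs s')" if "P s'" for s'
    using fold_invariant[of bs "\<lambda>_. True" P s' f] that assms(3) by blast
  ultimately show ?thesis
    using assms(2) by simp
qed

section \<open>Supports, closedness and h-closure in terms of subsequences\<close>

locale ranking_database =
  fixes objs :: "'a list" and N :: nat and \<pi> :: "nat \<Rightarrow> 'a list" and \<delta> :: real
  assumes N_pos: "1 \<le> N"
    and transactions: "i \<in> {1..N} \<Longrightarrow> \<pi> i \<in> rankings (set objs)"
    and \<delta>_pos: "0 < \<delta>"
begin

abbreviation "G \<equiv> g N \<pi>"
abbreviation "is_closed \<equiv> closed_ranking (set objs) N \<pi> \<delta>"
abbreviation "is_frequent \<equiv> frequent_ranking (set objs) N \<pi> \<delta>"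

text \<open>The local value \<open>R'\<close> of \<open>explore\<close>: the result list just before
  the deletion test, which is \<open>superseded\<close>.\<close>

definition explore_children :: "'a list \<Rightarrow> 'a list list \<Rightarrow> 'a list list" where
  "explore_children \<sigma> R =
     fold (\<lambda>x S. explore objs N \<pi> \<delta> (tail_transactions N \<pi> \<sigma> x) (\<sigma> @ [x]) S)
       (tail_objects objs N \<pi> \<delta> \<sigma>) (R @ [\<sigma>])"

definition superseded :: "'a list \<Rightarrow> bool" where
  "superseded \<sigma> \<longleftrightarrow>
     (\<exists>x\<in>set (tail_objects objs N \<pi> \<delta> \<sigma>).
        accepted objs N \<pi> \<delta> (tail_transactions N \<pi> \<sigma> x) (\<sigma> @ [x]) \<and> G (\<sigma> @ [x]) = G \<sigma>)"

lemma explore_eq: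
  "explore objs N \<pi> \<delta> T \<sigma> R =
     (if \<not> accepted objs N \<pi> \<delta> T \<sigma> then R
      else if superseded \<sigma> then removeAll \<sigma> (explore_children \<sigma> R)
      else explore_children \<sigma> R)"
  unfolding explore_children_def superseded_def by (subst explore.simps) (simp only: Let_def)

lemma rankings_iff:
  "\<sigma> \<in> rankings (set objs) \<longleftrightarrow> distinct \<sigma> \<and> set \<sigma> \<subseteq> set objs \<and> 2 \<le> length \<sigma>"
  using card_mono[of "set objs" "set \<sigma>"] by (auto simp: rankings_def distinct_card)

lemma ranking_snocE:
  assumes "\<sigma> \<in> rankings (set objs)"
  obtains c z where "\<sigma> = c @ [z]"
  using assms by (cases \<sigma> rule: rev_cases) (auto simp: rankings_iff)

lemma distinct_transaction: "i \<in> {1..N} \<Longrightarrow> distinct (\<pi> i)"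
  using transactions by (auto simp: rankings_def)

lemma g_eq: "G \<sigma> = {i \<in> {1..N}. subseq \<sigma> (\<pi> i)}"
  using distinct_transaction by (auto simp: g_def subranking_iff_subseq)

lemma finite_g [simp]: "finite (G \<sigma>)"
  by (simp add: g_def)

lemma g_antimono: "subseq \<rho> \<rho>' \<Longrightarrow> G \<rho>' \<subseteq> G \<rho>"
  by (auto simp: g_eq intro: subseq_order.trans)

lemma supp_mono: "G \<rho> \<subseteq> G \<rho>' \<Longrightarrow> supp N \<pi> \<rho> \<le> supp N \<pi> \<rho>'"
  by (simp add: supp_def card_mono divide_right_mono)

text \<open>Nested finite sets of equal size coincide. This replaces supports by transaction sets in
  the description of closedness.\<close>

lemma supp_less_iff: "G \<rho> \<subseteq> G \<rho>' \<Longrightarrow> supp N \<pi> \<rho> < supp N \<pi> \<rho>' \<longleftrightarrow> G \<rho> \<noteq> G \<rho>'"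
  using N_pos psubset_card_mono[of "G \<rho>'" "G \<rho>"]
  by (auto simp: supp_def divide_less_cancel)

lemma frequent_mono:
  "is_frequent \<rho> \<Longrightarrow> \<rho>' \<in> rankings (set objs) \<Longrightarrow> G \<rho> \<subseteq> G \<rho>' \<Longrightarrow> is_frequent \<rho>'"
  using supp_mono[of \<rho> \<rho>'] by (auto simp: frequent_ranking_def)

lemma strict_subranking_iff:
  "\<rho> \<in> rankings (set objs) \<Longrightarrow> \<rho>' \<in> rankings (set objs) \<Longrightarrow>
    strict_subranking \<rho> \<rho>' \<longleftrightarrow> subseq \<rho> \<rho>' \<and> \<rho>' \<noteq> \<rho>"
  by (auto simp: strict_subranking_def subranking_iff_subseq rankings_def
      intro: subseq_order.antisym)

lemma closed_iff:
  "is_closed \<rho> \<longleftrightarrow> is_frequent \<rho> \<and>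
    (\<forall>\<rho>'\<in>rankings (set objs). subseq \<rho> \<rho>' \<and> G \<rho>' = G \<rho> \<longrightarrow> \<rho>' = \<rho>)"
proof -
  have "(strict_subranking \<rho> \<rho>' \<longrightarrow> supp N \<pi> \<rho>' < supp N \<pi> \<rho>) \<longleftrightarrow>
      (subseq \<rho> \<rho>' \<and> G \<rho>' = G \<rho> \<longrightarrow> \<rho>' = \<rho>)"
    if "\<rho> \<in> rankings (set objs)" "\<rho>' \<in> rankings (set objs)" for \<rho>'
    using that supp_less_iff[OF g_antimono, of \<rho> \<rho>'] by (auto simp: strict_subranking_iff)
  then show ?thesis
    by (auto simp: closed_ranking_def frequent_ranking_def)
qed

text \<open>A ranking is common to all transactions in \<open>G \<rho>\<close> iff its own
  transaction set contains \<open>G \<rho>\<close>. Hence the h-closure depends on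
  \<open>\<rho>\<close> only through \<open>G \<rho>\<close>.\<close>

lemma h_closure_iff:
  "\<sigma> \<in> h_closure (set objs) N \<pi> \<rho> \<longleftrightarrow> \<sigma> \<in> rankings (set objs) \<and> G \<rho> \<subseteq> G \<sigma> \<and>
    (\<forall>\<tau>\<in>rankings (set objs). G \<rho> \<subseteq> G \<tau> \<and> subseq \<sigma> \<tau> \<longrightarrow> \<tau> = \<sigma>)"
proof -
  have "common_subrankings (set objs) \<pi> (G \<rho>) = {\<sigma> \<in> rankings (set objs). G \<rho> \<subseteq> G \<sigma>}"
    by (auto simp: common_subrankings_def g_def)
  then show ?thesis
    using strict_subranking_iff by (auto simp: h_closure_def)
qed

lemma finite_rankings: "finite (rankings (set objs))"
  using finite_lists_length_le[of "set objs" "card (set objs)"]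
  by (rule rev_finite_subset) (auto simp: rankings_def)

lemma ex_h_closure_above:
  assumes "\<sigma> \<in> rankings (set objs)"
  obtains \<eta> where "\<eta> \<in> h_closure (set objs) N \<pi> \<sigma>" "subseq \<sigma> \<eta>"
proof -
  let ?C = "{\<tau> \<in> rankings (set objs). G \<sigma> \<subseteq> G \<tau> \<and> subseq \<sigma> \<tau>}"
  have "finite ?C" "?C \<noteq> {}"
    using finite_rankings assms by auto
  \<comment> \<open>A longest common ranking above \<open>\<sigma>\<close> is maximal: whatever
    contains it is again above \<open>\<sigma>\<close>, so no longer, so equal.\<close>
  then obtain \<eta> where \<eta>: "\<eta> \<in> ?C" and max: "Max (length ` ?C) = length \<eta>"
    by (rule obtains_MAX)
  have longest: "length \<tau> \<le> length \<eta>" if "\<tau> \<in> ?C" for \<tau>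
    unfolding max[symmetric] using \<open>finite ?C\<close> that by (intro Max_ge finite_imageI imageI)
  have "\<eta> \<in> h_closure (set objs) N \<pi> \<sigma>"
    unfolding h_closure_iff
  proof (intro conjI ballI impI)
    fix \<tau> assume "\<tau> \<in> rankings (set objs)" "G \<sigma> \<subseteq> G \<tau> \<and> subseq \<eta> \<tau>"
    moreover from this \<eta> have "subseq \<sigma> \<tau>"
      using subseq_order.trans by blast
    ultimately show "\<tau> = \<eta>"
      using longest[of \<tau>] by (metis (lifting) list_emb_length le_antisym mem_Collect_eq subseq_same_length)
  qed (use \<eta> in auto)
  then show thesis
    using that \<eta> by blast
qed

section \<open>Tail extensions and the prefix test\<close>

lemma tail_transactions_eq:
  assumes "\<sigma> \<noteq> []"
  shows "tail_transactions N \<pi> \<sigma> x = G (\<sigma> @ [x])"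
proof -
  obtain c z where \<sigma>: "\<sigma> = c @ [z]"
    using assms by (metis append_butlast_last_id)
  \<comment> \<open>Splicing at \<open>z = last \<sigma>\<close> makes the frequency check by
    intersection exact.\<close>
  have "subseq (c @ [z, x]) (\<pi> i)"
    if "i \<in> {1..N}" "subseq (c @ [z]) (\<pi> i)" "subseq [z, x] (\<pi> i)" for i
    using subseq_splice[of "\<pi> i" c z "[]" "[]" "[x]"] distinct_transaction that by simp
  moreover have "subseq (c @ [z]) (c @ [z, x])" "subseq [z, x] (c @ [z, x])"
    by (simp_all add: list_emb_append_mono subseq_drop_many)
  ultimately show ?thesis
    unfolding tail_transactions_def g_eq \<sigma>
    by (auto intro: subseq_order.trans)
qed

lemma tail_extension_ranking:
  "\<sigma> \<in> rankings (set objs) \<Longrightarrow> x \<in> set (tail_objects objs N \<pi> \<delta> \<sigma>) \<Longrightarrow>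
    \<sigma> @ [x] \<in> rankings (set objs)"
  by (auto simp: rankings_iff tail_objects_def)

lemma accepted_iff:
  "\<sigma> \<in> rankings (set objs) \<Longrightarrow> accepted objs N \<pi> \<delta> (G \<sigma>) \<sigma> \<longleftrightarrow>
    is_frequent \<sigma> \<and> (\<exists>\<eta>\<in>h_closure (set objs) N \<pi> \<sigma>. prefix \<sigma> \<eta>)"
  by (simp add: accepted_def frequent_ranking_def supp_def)

text \<open>The pair of \<open>last \<sigma>\<close> and \<open>x\<close> is a subsequence of the
  longer frequent ranking, so the filter on 2-rankings never cuts the path to a frequent
  ranking.\<close>

lemma tail_object_if_frequent:
  assumes "\<sigma> \<in> rankings (set objs)" "\<sigma> @ x # r \<in> rankings (set objs)" "is_frequent (\<sigma> @ x # r)"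
  shows "x \<in> set (tail_objects objs N \<pi> \<delta> \<sigma>)"
proof -
  obtain c z where \<sigma>: "\<sigma> = c @ [z]"
    using assms(1) by (rule ranking_snocE)
  have "subseq [z, x] (c @ z # x # r)"
    by (simp add: subseq_drop_many)
  then have "G (\<sigma> @ x # r) \<subseteq> G [z, x]"
    using g_antimono by (simp add: \<sigma>)
  moreover have "[z, x] \<in> rankings (set objs)"
    using assms(2) by (auto simp: rankings_iff \<sigma>)
  ultimately have "is_frequent [z, x]"
    using frequent_mono assms(3) by blast
  then show ?thesis
    using assms(2) by (auto simp: tail_objects_def rankings_iff \<sigma>)
qed

lemma not_closed_superseded:
  assumes \<sigma>: "\<sigma> \<in> rankings (set objs)" and acc: "accepted objs N \<pi> \<delta> (G \<sigma>) \<sigma>"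
    and not_closed: "\<not> is_closed \<sigma>"
  shows "superseded \<sigma>"
proof -
  obtain \<eta> where freq: "is_frequent \<sigma>"
    and \<eta>: "\<eta> \<in> h_closure (set objs) N \<pi> \<sigma>" "prefix \<sigma> \<eta>"
    using acc accepted_iff \<sigma> by blast
  \<comment> \<open>If \<open>\<sigma>\<close> lay in its own h-closure, maximality there would make
    it closed.\<close>
  have "\<eta> \<noteq> \<sigma>"
    using \<eta>(1) not_closed freq by (auto simp: closed_iff h_closure_iff)
  then obtain x r where eta: "\<eta> = \<sigma> @ x # r"
    using \<eta>(2) by (metis prefixE append_Nil2 list.exhaust)
  have "G \<sigma> \<subseteq> G \<eta>" and \<eta>_ranking: "\<eta> \<in> rankings (set objs)"
    using \<eta>(1) by (auto simp: h_closure_iff)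
  moreover have "G \<eta> \<subseteq> G (\<sigma> @ [x])" "G (\<sigma> @ [x]) \<subseteq> G \<sigma>"
    unfolding eta by (auto intro!: g_antimono)
  ultimately have same: "G (\<sigma> @ [x]) = G \<sigma>"
    by blast
  have x: "x \<in> set (tail_objects objs N \<pi> \<delta> \<sigma>)"
    using tail_object_if_frequent[OF \<sigma>, of x r] frequent_mono[OF freq \<eta>_ranking]
      \<eta>_ranking \<open>G \<sigma> \<subseteq> G \<eta>\<close> by (auto simp: eta)
  have ext: "\<sigma> @ [x] \<in> rankings (set objs)"
    using tail_extension_ranking[OF \<sigma> x] .
  \<comment> \<open>Equal transaction sets give equal h-closures, so the same \<open>\<eta>\<close>
    witnesses the prefix test for the extension.\<close>
  have "\<eta> \<in> h_closure (set objs) N \<pi> (\<sigma> @ [x])"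
    using \<eta>(1) by (simp add: h_closure_iff same)
  moreover have "prefix (\<sigma> @ [x]) \<eta>"
    by (simp add: eta)
  moreover have "is_frequent (\<sigma> @ [x])"
    using frequent_mono[OF freq ext] same by simp
  ultimately have "accepted objs N \<pi> \<delta> (G (\<sigma> @ [x])) (\<sigma> @ [x])"
    using accepted_iff ext by blast
  moreover have "\<sigma> \<noteq> []"
    using \<sigma> by (auto simp: rankings_iff)
  ultimately show ?thesis
    unfolding superseded_def using x same tail_transactions_eq by metis
qed

lemma prefix_of_closed_accepted:
  assumes \<sigma>: "\<sigma> \<in> rankings (set objs)" and closed: "is_closed (\<sigma> @ r)"
  shows "accepted objs N \<pi> \<delta> (G \<sigma>) \<sigma>"
proof -
  obtain c z where sig: "\<sigma> = c @ [z]"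
    using \<sigma> by (rule ranking_snocE)
  have \<rho>: "\<sigma> @ r \<in> rankings (set objs)" "is_frequent (\<sigma> @ r)"
    using closed by (auto simp: closed_iff frequent_ranking_def)
  have sub: "G (\<sigma> @ r) \<subseteq> G \<sigma>"
    by (rule g_antimono) (simp add: prefix_imp_subseq)
  obtain \<eta> where \<eta>: "\<eta> \<in> h_closure (set objs) N \<pi> \<sigma>" "subseq \<sigma> \<eta>"
    using ex_h_closure_above[OF \<sigma>] .
  have \<eta>_ranking: "\<eta> \<in> rankings (set objs)" and \<sigma>\<eta>: "G \<sigma> \<subseteq> G \<eta>"
    using \<eta>(1) by (auto simp: h_closure_iff)
  have "z \<in> set \<eta>"
    using set_subseq[OF \<eta>(2)] sig by auto
  then obtain u v where eta: "\<eta> = u @ z # v"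
    by (meson split_list)
  have "subseq c u"
    using subseq_split_distinct(1)[of u z v c "[]"] \<eta> \<eta>_ranking by (simp add: eta sig rankings_iff)
  then have above: "subseq (\<sigma> @ r) (u @ z # r)"
    by (simp add: sig list_emb_append_mono)
  \<comment> \<open>Such a transaction contains \<open>\<eta>\<close>, which supplies the part up to
    \<open>z\<close>, and \<open>\<sigma> @ r\<close>, which supplies the part after it.\<close>
  have splice: "subseq (u @ z # r) (\<pi> i)" if "i \<in> G (\<sigma> @ r)" for i
  proof -
    have "subseq (u @ z # v) (\<pi> i)" "subseq (c @ z # r) (\<pi> i)" "i \<in> {1..N}"
      using that sub \<sigma>\<eta> by (auto simp: g_eq eta sig)
    then show ?thesis
      using subseq_splice distinct_transaction by metis
  qed
  \<comment> \<open>Since \<open>\<delta>\<close> is positive, some transaction contains the spliced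
    list, which is therefore duplicate-free and over the given objects.\<close>
  have "card (G (\<sigma> @ r)) > 0"
    using \<rho>(2) \<delta>_pos by (auto simp: frequent_ranking_def supp_def intro!: gr0I)
  then obtain i where i: "i \<in> G (\<sigma> @ r)"
    by fastforce
  then have "\<pi> i \<in> rankings (set objs)"
    using transactions by (auto simp: g_eq)
  moreover have "2 \<le> length (u @ z # r)"
    using \<rho>(1) list_emb_length[OF above] unfolding rankings_iff by linarith
  ultimately have "u @ z # r \<in> rankings (set objs)"
    using set_subseq[OF splice[OF i]] subseq_distinct[OF splice[OF i]]
    unfolding rankings_iff by blast
  moreover have "G (u @ z # r) = G (\<sigma> @ r)"
    using g_antimono[OF above] splice by (auto simp: g_eq)
  ultimately have "u @ z # r = \<sigma> @ r"
    using closed above by (auto simp: closed_iff)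
  \<comment> \<open>Cancelling \<open>z # r\<close> gives \<open>u = c\<close>.\<close>
  then have "prefix \<sigma> \<eta>"
    by (simp add: sig eta)
  moreover have "is_frequent \<sigma>"
    using frequent_mono[OF \<rho>(2) \<sigma> sub] .
  ultimately show ?thesis
    using accepted_iff[OF \<sigma>] \<eta>(1) by blast
qed

section \<open>Soundness and completeness of the depth-first traversal\<close>

lemma explore_sound:
  "\<sigma> \<in> rankings (set objs) \<Longrightarrow>
    set (explore objs N \<pi> \<delta> (G \<sigma>) \<sigma> R) \<subseteq> set R \<union> Collect is_closed"
proof (induction "card (set objs - set \<sigma>)" arbitrary: \<sigma> R rule: less_induct)
  case less
  have "\<sigma> \<noteq> []"
    using less.prems by (auto simp: rankings_iff)
  \<comment> \<open>At this stage \<open>\<sigma>\<close> is stored already, closed or not; the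
    deletion test decides about it only afterwards.\<close>
  have "set (explore_children \<sigma> R) \<subseteq> insert \<sigma> (set R) \<union> Collect is_closed"
    unfolding explore_children_def
  proof (rule fold_invariant[where P = "\<lambda>S. set S \<subseteq> insert \<sigma> (set R) \<union> Collect is_closed"
        and Q = "\<lambda>x. x \<in> set (tail_objects objs N \<pi> \<delta> \<sigma>)"])
    fix x S
    assume x: "x \<in> set (tail_objects objs N \<pi> \<delta> \<sigma>)"
      and S: "set S \<subseteq> insert \<sigma> (set R) \<union> Collect is_closed"
    have "set objs - set (\<sigma> @ [x]) \<subset> set objs - set \<sigma>"
      using x by (auto simp: tail_objects_def)
    then have "card (set objs - set (\<sigma> @ [x])) < card (set objs - set \<sigma>)"
      by (intro psubset_card_mono) auto
    from less.hyps[OF this tail_extension_ranking[OF less.prems x]] S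
    show "set (explore objs N \<pi> \<delta> (tail_transactions N \<pi> \<sigma> x) (\<sigma> @ [x]) S)
        \<subseteq> insert \<sigma> (set R) \<union> Collect is_closed"
      unfolding tail_transactions_eq[OF \<open>\<sigma> \<noteq> []\<close>] by blast
  qed auto
  then show ?case
    using not_closed_superseded[OF less.prems] by (auto simp: explore_eq)
qed

text \<open>A superseding child is a longer ranking with the same transactions, which closedness
  excludes.\<close>

lemma closed_not_superseded:
  assumes "is_closed \<sigma>"
  shows "\<not> superseded \<sigma>"
proof
  assume "superseded \<sigma>"
  then obtain x where x: "x \<in> set (tail_objects objs N \<pi> \<delta> \<sigma>)" "G (\<sigma> @ [x]) = G \<sigma>"
    by (auto simp: superseded_def)
  then have "\<sigma> @ [x] \<in> rankings (set objs)"
    using assms tail_extension_ranking by (auto simp: closed_iff frequent_ranking_def)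
  then show False
    using assms x(2) unfolding closed_iff by force
qed

text \<open>Only superseded rankings are ever deleted. With \<open>T\<close> and
  \<open>\<sigma>\<close> arbitrary, this covers every other branch of the search.\<close>

lemma explore_keeps_closed:
  assumes "is_closed \<rho>"
  shows "\<rho> \<in> set R \<Longrightarrow> \<rho> \<in> set (explore objs N \<pi> \<delta> T \<sigma> R)"
proof (induction "card (set objs - set \<sigma>)" arbitrary: T \<sigma> R rule: less_induct)
  case less
  have "\<rho> \<in> set (explore_children \<sigma> R)"
    unfolding explore_children_def
  proof (rule fold_invariant[where P = "\<lambda>S. \<rho> \<in> set S"
        and Q = "\<lambda>x. x \<in> set (tail_objects objs N \<pi> \<delta> \<sigma>)"])
    fix x S
    assume x: "x \<in> set (tail_objects objs N \<pi> \<delta> \<sigma>)" and S: "\<rho> \<in> set S"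
    have "set objs - set (\<sigma> @ [x]) \<subset> set objs - set \<sigma>"
      using x by (auto simp: tail_objects_def)
    then have "card (set objs - set (\<sigma> @ [x])) < card (set objs - set \<sigma>)"
      by (intro psubset_card_mono) auto
    from less.hyps[OF this S]
    show "\<rho> \<in> set (explore objs N \<pi> \<delta> (tail_transactions N \<pi> \<sigma> x) (\<sigma> @ [x]) S)" .
  qed (simp_all add: less.prems)
  then show ?case
    using less.prems closed_not_superseded[OF assms] by (auto simp: explore_eq)
qed

text \<open>The induction on the missing suffix \<open>r\<close> follows the path of prefixes of the
  closed ranking, each of which is accepted; at its end the ranking is stored and survives its own
  subtree.\<close>

lemma explore_finds_closed:
  "\<sigma> \<in> rankings (set objs) \<Longrightarrow> is_closed (\<sigma> @ r) \<Longrightarrow>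
    \<sigma> @ r \<in> set (explore objs N \<pi> \<delta> (G \<sigma>) \<sigma> R)"
proof (induction r arbitrary: \<sigma> R)
  case Nil
  have "\<sigma> \<in> set (explore_children \<sigma> R)"
    unfolding explore_children_def
    by (rule fold_invariant[where P = "\<lambda>S. \<sigma> \<in> set S" and Q = "\<lambda>_. True"])
      (use Nil.prems(2) in \<open>simp_all add: explore_keeps_closed\<close>)
  then show ?case
    using Nil.prems(2) prefix_of_closed_accepted[OF Nil.prems] closed_not_superseded[of \<sigma>]
    by (simp add: explore_eq)
next
  case (Cons x r)
  have x: "x \<in> set (tail_objects objs N \<pi> \<delta> \<sigma>)"
    using tail_object_if_frequent[OF Cons.prems(1)] Cons.prems(2)
    by (auto simp: closed_iff frequent_ranking_def)
  have "\<sigma> \<noteq> []"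
    using Cons.prems by (auto simp: rankings_iff)
  have "\<sigma> @ x # r \<in> set (explore_children \<sigma> R)"
    unfolding explore_children_def
  proof (rule fold_establishes[where P = "\<lambda>S. \<sigma> @ x # r \<in> set S", OF x])
    show "\<sigma> @ x # r \<in> set (explore objs N \<pi> \<delta> (tail_transactions N \<pi> \<sigma> x) (\<sigma> @ [x]) S)" for S
      using Cons.IH[OF tail_extension_ranking[OF Cons.prems(1) x], of S] Cons.prems(2)
      by (simp add: tail_transactions_eq[OF \<open>\<sigma> \<noteq> []\<close>])
  qed (rule explore_keeps_closed[OF Cons.prems(2)])
  then show ?case
    using prefix_of_closed_accepted[OF Cons.prems] by (simp add: explore_eq)
qed

section \<open>The whole run, started from the frequent 2-rankings\<close>

lemma gpminer_sound: "set (gpminer objs N \<pi> \<delta>) \<subseteq> Collect is_closed"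
  unfolding gpminer_def
proof (rule fold_invariant[where Q = "\<lambda>\<sigma>. \<sigma> \<in> rankings (set objs)"])
  fix \<sigma> S
  assume "\<sigma> \<in> rankings (set objs)" "set S \<subseteq> Collect is_closed"
  then show "set (explore objs N \<pi> \<delta> (G \<sigma>) \<sigma> S) \<subseteq> Collect is_closed"
    using explore_sound by blast
qed (auto simp: frequent_ranking_def)

lemma gpminer_complete:
  assumes "is_closed \<rho>"
  shows "\<rho> \<in> set (gpminer objs N \<pi> \<delta>)"
proof -
  have \<rho>: "\<rho> \<in> rankings (set objs)" "is_frequent \<rho>"
    using assms by (auto simp: closed_iff frequent_ranking_def)
  \<comment> \<open>The search tree that contains \<open>\<rho>\<close> is rooted at its two top
    objects.\<close>
  then obtain x y r where r: "\<rho> = [x, y] @ r"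
    by (auto simp: rankings_iff Suc_le_length_iff numeral_2_eq_2)
  then have xy: "[x, y] \<in> rankings (set objs)"
    using \<rho>(1) by (auto simp: rankings_iff)
  have "G \<rho> \<subseteq> G [x, y]"
    unfolding r by (rule g_antimono) simp
  then have "is_frequent [x, y]"
    using frequent_mono[OF \<rho>(2) xy] by blast
  then have "[x, y] \<in> set (filter is_frequent [[x, y]. x \<leftarrow> objs, y \<leftarrow> objs])"
    using xy by (auto simp: rankings_iff)
  then show ?thesis
    unfolding gpminer_def
    by (rule fold_establishes[where P = "\<lambda>S. \<rho> \<in> set S"])
      (use explore_finds_closed[OF xy] explore_keeps_closed[OF assms] assms in \<open>auto simp: r\<close>)
qed

end

theorem mainTheorem2:
  fixes Ob :: "'a set" and objs :: "'a list"
    and N :: nat and \<pi> :: "nat \<Rightarrow> 'a list" and \<delta> :: real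
  assumes "finite Ob" and "2 \<le> card Ob"
    and "distinct objs" and "set objs = Ob"
    and "1 \<le> N" and "\<forall>i\<in>{1..N}. \<pi> i \<in> rankings Ob"
    and "0 < \<delta>"
  shows "(\<forall>\<rho>. closed_ranking Ob N \<pi> \<delta> \<rho> \<longrightarrow> \<rho> \<in> set (gpminer objs N \<pi> \<delta>)) \<and>
         (\<forall>\<rho>\<in>set (gpminer objs N \<pi> \<delta>). closed_ranking Ob N \<pi> \<delta> \<rho>)"
proof -
  interpret ranking_database objs N \<pi> \<delta>
    using assms by unfold_locales auto
  show ?thesis
    using gpminer_sound gpminer_complete assms(4) by blast
qed

end
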